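(* Let $X$ be a commutative semigroup and let $\varphi(X)$ be the semigroup (under $*$) of filters on $X$. The following conditions are equivalent: (1) $\varphi(X)$ is commutative; (2) $\varphi(X)$ is supercommutative; (3) $\{a_kb_n : k,n\in\omega,\ k\le n\}\cap\{b_na_{n+1} : n\in\omega\}\ne\emptyset$ for any sequences $(a_n)_{n\in\omega}$ and $(b_n)_{n\in\omega}$ in $X$.
   Context: $\omega=\{0,1,2,\dots\}$. An upfamily on a nonempty set $X$ is a nonempty family $\mathcal F$ of nonempty subsets of $X$ such that $F\in\mathcal F$ and $F\subset E\subset X$ imply $E\in\mathcal F$; $\upsilon(X)$ is the set of all upfamilies on $X$. A family $\mathcal G$ of nonempty subsets of $X$ generates the upfamily $\langle G:G\in\mathcal G\rangle=\{E\subset X:\exists G\in\mathcal G,\ G\subset E\}$. A filter on $X$ is an upfamily $\mathcal F$ with $A\cap B\in\mathcal F$ for all $A,B\in\mathcal F$; $\varphi(X)\subset\upsilon(X)$ is the set of all filters. If $X$ is a semigroup, put for $\mathcal A,\mathcal B\in\upsilon(X)$: $\mathcal A*\mathcal B=\langle\bigcup_{a\in A}aB_a: A\in\mathcal A,\ (B_a)_{a\in A}\in\mathcal B^A\rangle$ and $\mathcal A\circledast\mathcal B=\langle AB:A\in\mathcal A,\ B\in\mathcal B\rangle$, where $AB=\{ab:a\in A,b\in B\}$. The operation $*$ is associative and $\varphi(X)$ is a subsemigroup of $(\upsilon(X),* )$. A subsemigroup $S$ of $(\upsilon(X),* )$ is commutative if $\mathcal A*\mathcal B=\mathcal B*\mathcal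 A$ for all $\mathcal A,\mathcal B\in S$, and supercommutative if $\mathcal A*\mathcal B=\mathcal A\circledast\mathcal B=\mathcal B\circledast\mathcal A=\mathcal B*\mathcal A$ for all $\mathcal A,\mathcal B\in S$. *)

theory Defs
  imports Main
begin

definition upfamilies :: "'a set set set" where
  "upfamilies = {\<F>. \<F> \<noteq> {} \<and> {} \<notin> \<F> \<and> (\<forall>F\<in>\<F>. \<forall>E. F \<subseteq> E \<longrightarrow> E \<in> \<F>)}"

definition generated_upfamily :: "'a set set \<Rightarrow> 'a set set" where
  "generated_upfamily \<G> = {E. \<exists>G\<in>\<G>. G \<subseteq> E}"

text \<open>Filters are proper here (the empty set is never a member), unlike elements of the
  library type \<^typ>\<open>'a filter\<close>, which include \<^term>\<open>bot\<close>.\<close>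

definition filters :: "'a set set set" where
  "filters = {\<F> \<in> upfamilies. \<forall>A\<in>\<F>. \<forall>B\<in>\<F>. A \<inter> B \<in> \<F>}"

text \<open>In \<open>upfamily_mult\<close> the indexed family \<open>Bf\<close> is a total function that is constrained,
  and used, only on the index set \<open>A\<close>.\<close>

definition upfamily_mult ::
    "'a::semigroup_mult set set \<Rightarrow> 'a set set \<Rightarrow> 'a set set"  (infixl "\<star>" 70) where
  "\<A> \<star> \<B> = generated_upfamily
     {\<Union>a\<in>A. (\<lambda>x. a * x) ` Bf a | A Bf. A \<in> \<A> \<and> (\<forall>a\<in>A. Bf a \<in> \<B>)}"

definition upfamily_setmult ::
    "'a::semigroup_mult set set \<Rightarrow> 'a set set \<Rightarrow> 'a set set"  (infixl "\<circledast>" 70) where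
  "\<A> \<circledast> \<B> = generated_upfamily
     {{a * b | a b. a \<in> A \<and> b \<in> B} | A B. A \<in> \<A> \<and> B \<in> \<B>}"

definition commutative_upfamilies :: "'a::semigroup_mult set set set \<Rightarrow> bool" where
  "commutative_upfamilies S \<longleftrightarrow> (\<forall>\<A>\<in>S. \<forall>\<B>\<in>S. \<A> \<star> \<B> = \<B> \<star> \<A>)"

definition supercommutative_upfamilies :: "'a::semigroup_mult set set set \<Rightarrow> bool" where
  "supercommutative_upfamilies S \<longleftrightarrow>
     (\<forall>\<A>\<in>S. \<forall>\<B>\<in>S. \<A> \<star> \<B> = \<A> \<circledast> \<B> \<and> \<A> \<circledast> \<B> = \<B> \<circledast> \<A> \<and> \<B> \<circledast> \<A> = \<B> \<star> \<A>)"

end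

theory Submission
  imports Defs
begin

text \<open>If a set \<open>E \<supseteq> (\<Union>a\<in>A. a B\<^sub>a)\<close> contains no product \<open>A'B'\<close> with \<open>A' \<in> \<A>\<close>, \<open>B' \<in> \<B>\<close>, then
  choosing alternately \<open>b\<^sub>n \<in> (\<Inter>k\<le>n. B\<^bsub>a k\<^esub>)\<close> and \<open>a\<^bsub>n+1\<^esub> \<in> A\<close> with \<open>a\<^bsub>n+1\<^esub> b\<^sub>n \<notin> E\<close> yields sequences
  that violate condition (3). Conversely, for sequences violating (3), the principal filter of
  \<open>{a\<^sub>n : n}\<close> and the filter generated by the tails of \<open>b\<close> do not commute: \<open>{a\<^sub>k b\<^sub>n : k \<le> n}\<close> lies in
  one of the two products only.\<close>

lemma filters_iff:
  "\<F> \<in> filters \<longleftrightarrow> \<F> \<noteq> {} \<and> {} \<notin> \<F> \<and> (\<forall>F E. F \<in> \<F> \<longrightarrow> F \<subseteq> E \<longrightarrow> E \<in> \<F>)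
     \<and> (\<forall>A B. A \<in> \<F> \<longrightarrow> B \<in> \<F> \<longrightarrow> A \<inter> B \<in> \<F>)"
  unfolding filters_def upfamilies_def by (simp add: Ball_def imp_conjR conj_assoc)

lemma filters_INT:
  assumes "\<F> \<in> filters" "finite S" "S \<noteq> {}" "\<And>x. x \<in> S \<Longrightarrow> B x \<in> \<F>"
  shows "(\<Inter>x\<in>S. B x) \<in> \<F>"
  using assms(2,3,4)
proof (induction rule: finite_ne_induct)
  case (insert x S)
  then show ?case using assms(1) by (simp add: filters_iff)
qed simp

text \<open>Criterion for a filter base, meant for two generated families: the principal one of
  \<open>range a\<close> and the one of the tails of \<open>b\<close>.\<close>

lemma generated_upfamily_in_filters:
  assumes "\<G> \<noteq> {}" "{} \<notin> \<G>" "\<And>A B. A \<in> \<G> \<Longrightarrow> B \<in> \<G> \<Longrightarrow> \<exists>C\<in>\<G>. C \<subseteq> A \<inter> B"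
  shows "generated_upfamily \<G> \<in> filters"
  unfolding filters_iff
proof (intro conjI allI impI)
  show "generated_upfamily \<G> \<noteq> {}" "{} \<notin> generated_upfamily \<G>"
    using assms(1,2) unfolding generated_upfamily_def by auto
  show "E \<in> generated_upfamily \<G>" if "F \<in> generated_upfamily \<G>" "F \<subseteq> E" for F E
    using that unfolding generated_upfamily_def by blast
  fix A B assume "A \<in> generated_upfamily \<G>" "B \<in> generated_upfamily \<G>"
  then obtain G H where G: "G \<in> \<G>" "G \<subseteq> A" and H: "H \<in> \<G>" "H \<subseteq> B"
    unfolding generated_upfamily_def by blast
  obtain C where C: "C \<in> \<G>" "C \<subseteq> G \<inter> H"
    using assms(3)[OF G(1) H(1)] by (elim bexE)
  have "C \<subseteq> A \<inter> B" using C(2) G(2) H(2) by auto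
  with C(1) show "A \<inter> B \<in> generated_upfamily \<G>"
    unfolding generated_upfamily_def by (intro CollectI bexI)
qed

text \<open>Pointwise form of the product: the witnesses \<open>A\<close> and \<open>Bf\<close> can
  be supplied or extracted without handling unions of translates.\<close>

lemma mem_upfamily_mult:
  "E \<in> \<A> \<star> \<B> \<longleftrightarrow> (\<exists>A\<in>\<A>. \<exists>Bf. \<forall>a\<in>A. Bf a \<in> \<B> \<and> (\<forall>b\<in>Bf a. a * b \<in> E))"
proof -
  have "E \<in> \<A> \<star> \<B> \<longleftrightarrow>
      (\<exists>A Bf. A \<in> \<A> \<and> (\<forall>a\<in>A. Bf a \<in> \<B>) \<and> (\<Union>a\<in>A. (*) a ` Bf a) \<subseteq> E)"
    unfolding upfamily_mult_def generated_upfamily_def by blast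
  also have "\<dots> \<longleftrightarrow> (\<exists>A\<in>\<A>. \<exists>Bf. \<forall>a\<in>A. Bf a \<in> \<B> \<and> (\<forall>b\<in>Bf a. a * b \<in> E))"
    unfolding UN_subset_iff image_subset_iff Bex_def ball_conj_distrib by simp
  finally show ?thesis .
qed

lemma mem_upfamily_setmult:
  "E \<in> \<A> \<circledast> \<B> \<longleftrightarrow> (\<exists>A\<in>\<A>. \<exists>B\<in>\<B>. \<forall>a\<in>A. \<forall>b\<in>B. a * b \<in> E)"
proof -
  have "E \<in> \<A> \<circledast> \<B> \<longleftrightarrow> (\<exists>A\<in>\<A>. \<exists>B\<in>\<B>. {a * b | a b. a \<in> A \<and> b \<in> B} \<subseteq> E)"
    unfolding upfamily_setmult_def generated_upfamily_def by blast
  moreover have "{a * b | a b. a \<in> A \<and> b \<in> B} \<subseteq> E \<longleftrightarrow> (\<forall>a\<in>A. \<forall>b\<in>B. a * b \<in> E)" for A B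
    by blast
  ultimately show ?thesis by simp
qed

text \<open>A set AB is the union of the aB over a in A, that is, the case of a constant
  family.\<close>

lemma upfamily_setmult_subset_mult: "\<A> \<circledast> \<B> \<subseteq> \<A> \<star> \<B>"
proof
  fix E assume "E \<in> \<A> \<circledast> \<B>"
  then obtain A B where "A \<in> \<A>" "B \<in> \<B>" "\<forall>a\<in>A. \<forall>b\<in>B. a * b \<in> E"
    unfolding mem_upfamily_setmult by blast
  then show "E \<in> \<A> \<star> \<B>"
    unfolding mem_upfamily_mult by (intro bexI[of _ A] exI[of _ "\<lambda>_. B"]) auto
qed

lemma upfamily_setmult_commute:
  fixes \<A> \<B> :: "'a::ab_semigroup_mult set set"
  shows "\<A> \<circledast> \<B> = \<B> \<circledast> \<A>"
proof -
  have "\<C> \<circledast> \<D> \<subseteq> \<D> \<circledast> \<C>" for \<C> \<D> :: "'a set set"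
  proof
    fix E assume "E \<in> \<C> \<circledast> \<D>"
    then obtain C D where "C \<in> \<C>" "D \<in> \<D>" "\<forall>c\<in>C. \<forall>d\<in>D. c * d \<in> E"
      unfolding mem_upfamily_setmult by blast
    then show "E \<in> \<D> \<circledast> \<C>"
      unfolding mem_upfamily_setmult by (metis mult.commute)
  qed
  then show ?thesis by blast
qed

lemma upfamily_mult_eq_setmult:
  fixes \<A> \<B> :: "'a::ab_semigroup_mult set set"
  assumes seqs: "\<And>(a :: nat \<Rightarrow> 'a) b. \<exists>k n m. k \<le> n \<and> a k * b n = b m * a (Suc m)"
    and \<A>: "\<A> \<in> filters" and \<B>: "\<B> \<in> filters"
  shows "\<A> \<star> \<B> = \<A> \<circledast> \<B>"
proof (rule antisym[OF subsetI upfamily_setmult_subset_mult], rule ccontr)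
  fix E assume "E \<in> \<A> \<star> \<B>" and notin: "E \<notin> \<A> \<circledast> \<B>"
  then obtain A Bf where A: "A \<in> \<A>" and Bf: "\<And>x. x \<in> A \<Longrightarrow> Bf x \<in> \<B>"
    and prod: "\<And>x y. x \<in> A \<Longrightarrow> y \<in> Bf x \<Longrightarrow> x * y \<in> E"
    unfolding mem_upfamily_mult by blast
  obtain a0 where a0: "a0 \<in> A" using A \<A> unfolding filters_iff by blast
  \<comment> \<open>The intersection is a member of \<B>, so if all its products with
    \<open>A\<close> lay in \<open>E\<close>, then \<open>E\<close> would belong to
    \<open>\<A> \<circledast> \<B>\<close>.\<close>
  have "\<exists>y z. y \<in> (\<Inter>x\<in>S. Bf x) \<and> z \<in> A \<and> z * y \<notin> E" if "finite S" "S \<noteq> {}" "S \<subseteq> A" for S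
  proof -
    have "(\<Inter>x\<in>S. Bf x) \<in> \<B>" using that Bf by (intro filters_INT[OF \<B>]) auto
    with A notin show ?thesis unfolding mem_upfamily_setmult by blast
  qed
  then obtain f g where fg: "\<And>S. finite S \<Longrightarrow> S \<noteq> {} \<Longrightarrow> S \<subseteq> A \<Longrightarrow>
      f S \<in> (\<Inter>x\<in>S. Bf x) \<and> g S \<in> A \<and> g S * f S \<notin> E"
    by metis
  \<comment> \<open>Each choice depends on all earlier ones, so the recursion runs over the finite
    set of elements of \<open>A\<close> chosen so far.\<close>
  define T where "T = rec_nat {a0} (\<lambda>_ S. insert (g S) S)"
  have T: "T 0 = {a0}" "T (Suc n) = insert (g (T n)) (T n)" for n by (simp_all add: T_def)
  have Tok: "finite (T n) \<and> T n \<noteq> {} \<and> T n \<subseteq> A" for n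
    by (induction n) (use a0 fg in \<open>auto simp: T\<close>)
  \<comment> \<open>With this shift \<open>T n\<close> is the set of a 0, ..., a n. Hence
    \<open>b n\<close> is chosen from the sets \<open>Bf (a k)\<close> with k \<le> n, and
    \<open>a (Suc n)\<close> is the element chosen together with \<open>b n\<close> so that their
    product avoids \<open>E\<close>.\<close>
  define a where "a = case_nat a0 (\<lambda>n. g (T n))"
  define b where "b = (\<lambda>n. f (T n))"
  have "T k \<subseteq> T n" if "k \<le> n" for k n
    by (rule lift_Suc_mono_le[OF _ that]) (auto simp: T)
  moreover have "a k \<in> T k" for k by (cases k) (auto simp: a_def T)
  ultimately have aT: "a k \<in> T n" if "k \<le> n" for k n using that by blast
  have "a k * b n \<in> E" if "k \<le> n" for k n
  proof (rule prod)
    show "a k \<in> A" using aT[OF that] Tok by blast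
    show "b n \<in> Bf (a k)" using fg[of "T n"] Tok[of n] aT[OF that] by (auto simp: b_def)
  qed
  moreover have "b m * a (Suc m) \<notin> E" for m
    using fg[of "T m"] Tok[of m] by (simp add: a_def b_def mult.commute)
  ultimately show False using seqs[of a b] by metis
qed

lemma commutative_filters_imp:
  fixes a b :: "nat \<Rightarrow> 'a::ab_semigroup_mult"
  assumes "commutative_upfamilies (filters :: 'a set set set)"
  shows "\<exists>k n m. k \<le> n \<and> a k * b n = b m * a (Suc m)"
proof -
  define \<A> where "\<A> = generated_upfamily {range a}"
  define \<B> where "\<B> = generated_upfamily (range (\<lambda>n. b ` {n..}))"
  define E where "E = {a k * b n | k n. k \<le> n}"
  have "\<A> \<in> filters"
    unfolding \<A>_def by (rule generated_upfamily_in_filters) auto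
  moreover have "\<B> \<in> filters"
    unfolding \<B>_def
  proof (rule generated_upfamily_in_filters)
    fix C D assume "C \<in> range (\<lambda>n. b ` {n..})" "D \<in> range (\<lambda>n. b ` {n..})"
    then obtain i j where "C = b ` {i..}" "D = b ` {j..}" by (elim rangeE)
    then have "b ` {max i j..} \<subseteq> C \<inter> D" by auto
    then show "\<exists>G\<in>range (\<lambda>n. b ` {n..}). G \<subseteq> C \<inter> D" by (rule bexI) (rule rangeI)
  qed auto
  ultimately have comm: "\<A> \<star> \<B> = \<B> \<star> \<A>"
    using assms unfolding commutative_upfamilies_def by blast
  have "range a \<in> \<A>" unfolding \<A>_def generated_upfamily_def by blast
  \<comment> \<open>\<open>inv a x\<close> is one index k with a k = x; on the tail of
    \<open>b\<close> from k on, every product x * b n is of the form a k * b n with k \<le>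
    n.\<close>
  moreover have "b ` {inv a x..} \<in> \<B> \<and> (\<forall>y\<in>b ` {inv a x..}. x * y \<in> E)" if "x \<in> range a" for x
  proof -
    have "x * b n \<in> E" if "inv a x \<le> n" for n
      unfolding E_def mem_Collect_eq
      by (intro exI[of _ "inv a x"] exI[of _ n]) (simp add: f_inv_into_f[OF \<open>x \<in> range a\<close>] that)
    moreover have "b ` {inv a x..} \<in> \<B>" unfolding \<B>_def generated_upfamily_def by blast
    ultimately show ?thesis by simp
  qed
  ultimately have "E \<in> \<A> \<star> \<B>"
    unfolding mem_upfamily_mult by (intro bexI[of _ "range a"] exI[of _ "\<lambda>x. b ` {inv a x..}"] ballI)
  then obtain B Af where B: "B \<in> \<B>"
    and Af: "\<And>y. y \<in> B \<Longrightarrow> Af y \<in> \<A>" "\<And>x y. y \<in> B \<Longrightarrow> x \<in> Af y \<Longrightarrow> y * x \<in> E"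
    unfolding comm mem_upfamily_mult by blast
  \<comment> \<open>\<open>B\<close> contains a tail of \<open>b\<close>, hence some value
    \<open>b m\<close>.\<close>
  obtain m where m: "b m \<in> B" using B unfolding \<B>_def generated_upfamily_def by auto
  \<comment> \<open>Every member of the principal filter \<A> contains all of
    \<open>range a\<close>, so the index \<open>Suc m\<close> may be picked after m is
    known.\<close>
  have "a (Suc m) \<in> Af (b m)"
    using Af(1)[OF m] by (auto simp: \<A>_def generated_upfamily_def)
  then have "b m * a (Suc m) \<in> E" by (rule Af(2)[OF m])
  then show ?thesis unfolding E_def mem_Collect_eq by metis
qed

theorem theorem6p3:
  "(commutative_upfamilies (filters :: 'a::ab_semigroup_mult set set set)
      \<longleftrightarrow> supercommutative_upfamilies (filters :: 'a set set set))
   \<and> (supercommutative_upfamilies (filters :: 'a set set set)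
      \<longleftrightarrow> (\<forall>(a :: nat \<Rightarrow> 'a) (b :: nat \<Rightarrow> 'a).
            {a k * b n | k n. k \<le> n} \<inter> {b n * a (Suc n) | n. True} \<noteq> {}))"
proof -
  let ?F = "filters :: 'a set set set"
  let ?seqs = "\<forall>(a :: nat \<Rightarrow> 'a) b. \<exists>k n m. k \<le> n \<and> a k * b n = b m * a (Suc m)"
  \<comment> \<open>Turns the nonempty intersection into an equation between two products, the form
    used by the lemmas on sequences.\<close>
  have seqs_iff: "({a k * b n | k n. k \<le> n} \<inter> {b n * a (Suc n) | n. True} \<noteq> {})
      \<longleftrightarrow> (\<exists>k n m. k \<le> n \<and> a k * b n = b m * a (Suc m))"
    (is "?X \<inter> ?Y \<noteq> {} \<longleftrightarrow> ?R") for a b :: "nat \<Rightarrow> 'a"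
  proof
    assume "?X \<inter> ?Y \<noteq> {}"
    then obtain x where "x \<in> ?X" "x \<in> ?Y" unfolding ex_in_conv[symmetric] by (elim exE IntE)
    then obtain k n m where "k \<le> n" "x = a k * b n" "x = b m * a (Suc m)"
      unfolding mem_Collect_eq by (elim exE conjE)
    then have "k \<le> n \<and> a k * b n = b m * a (Suc m)" by simp
    then show ?R by (intro exI)
  next
    assume ?R
    then obtain k n m where kn: "k \<le> n" and eq: "a k * b n = b m * a (Suc m)"
      by (elim exE conjE)
    have "a k * b n \<in> ?X \<inter> ?Y"
      using kn by (intro IntI CollectI exI conjI) (rule refl eq TrueI | assumption)+
    then show "?X \<inter> ?Y \<noteq> {}" unfolding ex_in_conv[symmetric] by (rule exI)
  qed
  \<comment> \<open>The equivalences come from a cycle: supercommutativity gives commutativity,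
    which gives the condition on sequences, which gives supercommutativity.\<close>
  have "commutative_upfamilies ?F" if super: "supercommutative_upfamilies ?F"
    unfolding commutative_upfamilies_def
  proof (intro ballI)
    fix \<A> \<B> :: "'a set set"
    assume "\<A> \<in> filters" "\<B> \<in> filters"
    then have "\<A> \<star> \<B> = \<A> \<circledast> \<B> \<and> \<A> \<circledast> \<B> = \<B> \<circledast> \<A> \<and> \<B> \<circledast> \<A> = \<B> \<star> \<A>"
      by (rule super[unfolded supercommutative_upfamilies_def, THEN bspec, THEN bspec])
    then show "\<A> \<star> \<B> = \<B> \<star> \<A>" by (elim conjE) (rule trans[OF _ trans])
  qed
  moreover have "commutative_upfamilies ?F \<Longrightarrow> ?seqs"
    by (intro allI commutative_filters_imp)
  moreover have "supercommutative_upfamilies ?F" if seqs: ?seqs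
    unfolding supercommutative_upfamilies_def
  proof (intro ballI conjI)
    fix \<A> \<B> :: "'a set set"
    assume \<A>: "\<A> \<in> filters" and \<B>: "\<B> \<in> filters"
    show "\<A> \<star> \<B> = \<A> \<circledast> \<B>"
      by (rule upfamily_mult_eq_setmult[OF seqs[rule_format] \<A> \<B>])
    show "\<A> \<circledast> \<B> = \<B> \<circledast> \<A>" by (rule upfamily_setmult_commute)
    \<comment> \<open>The condition on sequences does not mention the filters, so their roles can be
      exchanged.\<close>
    show "\<B> \<circledast> \<A> = \<B> \<star> \<A>"
      by (rule upfamily_mult_eq_setmult[OF seqs[rule_format] \<B> \<A>, symmetric])
  qed
  ultimately show ?thesis unfolding seqs_iff by argo
qed

end
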